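(* Let $f(x),g(x)\in\mathbb{Z}[x]$, let $f(x)$ be separable with $\deg f(x)>2$, and let $$g(y)=g_1(y)^{\gamma_1}g_2(y)^{\gamma_2}\cdots g_n(y)^{\gamma_n},$$ where $n$ is a positive integer, $\gamma_1,\gamma_2,\dots,\gamma_n$ are integers $\ge 2$, and $g_i(x)\in\mathbb{Z}[x]$ for $i=1,2,\dots,n$. If the $ABC$-Conjecture is assumed, then the equation $f(x)=g(y)$ has only finitely many solutions $(x,y)$ in integers.
   Context: A polynomial is separable if it has no repeated roots (in $\mathbb{C}$). The $ABC$-Conjecture is the following assertion: for every fixed $\epsilon>0$ there is a constant $C_\epsilon$ such that, whenever $a,b,c$ are coprime positive integers with $a+b=c$, one has $c\le C_\epsilon\,N(a,b,c)^{1+\epsilon}$, where $N(a,b,c)$ is the product of the distinct prime divisors of $abc$.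
   Formalization: The polynomial g is additionally assumed to be nonconstant; without this the claim fails, e.g. for f = x^3 - x and g = 0^2, where (0, y) is a solution for every integer y. *)

theory Defs
  imports Complex_Main "HOL-Computational_Algebra.Computational_Algebra"
begin

definition separable_int_poly :: "int poly \<Rightarrow> bool" where
  "separable_int_poly f \<longleftrightarrow> rsquarefree (map_poly (of_int :: int \<Rightarrow> complex) f)"

definition abc_N :: "nat \<Rightarrow> nat \<Rightarrow> nat \<Rightarrow> nat" where
  "abc_N a b c = \<Prod>(prime_factors (a * b * c))"

(* Gcd {a, b, c} = 1 is coprimality of the triple; since a + b = c, pairwise coprimality
   would describe the same triples. *)
definition ABC_Conjecture :: bool where
  "ABC_Conjecture \<longleftrightarrow>
     (\<forall>\<epsilon>::real. \<epsilon> > 0 \<longrightarrow>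
       (\<exists>C::real. \<forall>a b c :: nat.
          a > 0 \<longrightarrow> b > 0 \<longrightarrow> c > 0 \<longrightarrow> Gcd {a, b, c} = 1 \<longrightarrow> a + b = c \<longrightarrow>
          real c \<le> C * real (abc_N a b c) powr (1 + \<epsilon>)))"

end

theory Submission
  imports Defs "HOL-Computational_Algebra.Field_as_Ring"
begin

text \<open>
  Belyi's argument over \<open>\<rat>[x]\<close>: every separable \<open>f\<close> admits a nonconstant rational polynomial \<open>\<phi>\<close>
  that maps the roots of \<open>f\<close> and its own critical points to \<open>{0, 1}\<close>. This is expressed as
  \<open>\<phi>' * f dvd (\<phi> * (\<phi> - 1)) ^ N\<close>, a relation that composes well. Counting multiplicities,
  \<open>\<phi> * (\<phi> - 1)\<close> has \<open>degree \<phi> + 1\<close> distinct roots, namely those of \<open>f * h\<close> for a suitable cofactor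
  \<open>h\<close>. After clearing denominators, \<open>\<phi> = P / M\<close>, and the ABC conjecture for \<open>P x\<close>, \<open>M\<close>, \<open>P x - M\<close>
  bounds \<open>\<bar>x\<bar> ^ degree \<phi>\<close> essentially by \<open>rad (f x) * \<bar>h x\<bar>\<close>, so that \<open>rad (f x)\<close> is at least about
  \<open>\<bar>x\<bar> ^ (degree f - 1)\<close>. But \<open>f x = g y\<close> is divisible by the square of each of its prime
  factors, so \<open>rad (f x) \<le> \<bar>f x\<bar> powr (1 / 2)\<close>, and \<open>degree f / 2 < degree f - 1\<close>.
\<close>

section \<open>Belyi polynomials\<close>

lemma vector_space_smult: "vector_space (smult :: 'a::field \<Rightarrow> 'a poly \<Rightarrow> 'a poly)"
  by unfold_locales (simp_all add: smult_add_right smult_add_left)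

text \<open>These are \<open>n + 1\<close> vectors in the \<open>n\<close>-dimensional space of
  polynomials of degree below \<open>n\<close>. Repeated entries get an explicit relation, since
  \<open>dependent\<close> speaks of sets.\<close>

lemma polys_linearly_dependent:
  fixes v :: "nat \<Rightarrow> 'a::field poly"
  assumes v: "\<And>i k. i \<le> n \<Longrightarrow> k \<ge> n \<Longrightarrow> coeff (v i) k = 0"
  obtains c i where "i \<le> n" "c i \<noteq> 0" "(\<Sum>i\<le>n. smult (c i) (v i)) = 0"
proof (cases "inj_on v {..n}")
  case False
  then obtain i j where ij: "i \<le> n" "j \<le> n" "i \<noteq> j" "v i = v j"
    by (auto simp: inj_on_def)
  define c where "c = (\<lambda>k. if k = i then 1 else if k = j then - 1 else (0::'a))"
  have "(\<Sum>k\<le>n. smult (c k) (v k)) = (\<Sum>k\<in>{i,j}. smult (c k) (v k))"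
    using ij by (intro sum.mono_neutral_right) (auto simp: c_def)
  also have "\<dots> = 0"
    using ij by (simp add: c_def)
  finally show ?thesis
    using that[of i c] ij by (auto simp: c_def)
next
  case True
  interpret vector_space "smult :: 'a \<Rightarrow> 'a poly \<Rightarrow> 'a poly"
    by (rule vector_space_smult)
  define B where "B = (\<lambda>k. monom (1::'a) k) ` {..<n}"
  have "v i \<in> span B" if "i \<le> n" for i
  proof -
    have "v i = (\<Sum>k<n. smult (coeff (v i) k) (monom 1 k))"
      using v[OF that]
      by (intro poly_eqI) (auto simp: coeff_sum if_distrib sum.If_cases not_less cong: if_cong)
    also have "\<dots> \<in> span B"
      by (intro span_sum span_scale span_base) (auto simp: B_def)
    finally show ?thesis .
  qed
  then have "v ` {..n} \<subseteq> span B" by auto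
  moreover have "finite B" "card B \<le> n"
    unfolding B_def using card_image_le[of "{..<n}"] by auto
  moreover have "card (v ` {..n}) = Suc n"
    using True by (simp add: card_image)
  ultimately have "dependent (v ` {..n})"
    using independent_span_bound[of B "v ` {..n}"] by force
  then obtain u w where w: "w \<in> v ` {..n}" "u w \<noteq> 0" "(\<Sum>w\<in>v ` {..n}. smult (u w) w) = 0"
    by (subst (asm) dependent_finite) auto
  then obtain i where "i \<le> n" "w = v i" by auto
  with w show ?thesis
    using that[of i "u \<circ> v"] sum.reindex[OF True, of "\<lambda>w. smult (u w) w"] by (simp add: o_def)
qed

lemma pcompose_power: "pcompose (p ^ n) q = pcompose p q ^ n"
  for p q :: "'a::comm_semiring_1 poly"
  by (induction n) (simp_all add: pcompose_mult pcompose_1)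

lemma pcompose_dvd: "p dvd q \<Longrightarrow> pcompose p r dvd pcompose q r"
  for p q r :: "'a::comm_semiring_1 poly"
  by (auto simp: dvd_def pcompose_mult)

text \<open>The quotient by \<open>d\<close> has dimension \<open>degree d\<close>, so the residues
  of \<open>f ^ 0, ..., f ^ degree d\<close> satisfy a linear relation, whose coefficients form
  \<open>q\<close>. For \<open>d = pderiv f\<close> this \<open>q\<close> vanishes at the critical
  values of \<open>f\<close>.\<close>

lemma exists_dvd_pcompose:
  fixes d f :: "'a::field poly"
  assumes "d \<noteq> 0"
  obtains q where "q \<noteq> 0" "degree q \<le> degree d" "d dvd pcompose q f"
proof -
  define n where "n = degree d"
  have "coeff (f ^ i mod d) k = 0" if "k \<ge> n" for i k
    using degree_mod_less[OF assms, of "f ^ i"] that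
    by (auto simp: n_def intro: coeff_eq_0)
  from polys_linearly_dependent[of n "\<lambda>i. f ^ i mod d", OF this] obtain c i where
    c: "i \<le> n" "c i \<noteq> 0" "(\<Sum>i\<le>n. smult (c i) (f ^ i mod d)) = 0"
    by blast
  define q where "q = (\<Sum>i\<le>n. monom (c i) i)"
  have coeff_q: "coeff q k = (if k \<le> n then c k else 0)" for k
    by (simp add: q_def coeff_sum)
  have "q \<noteq> 0"
    using c coeff_q[of i] by auto
  moreover have "degree q \<le> degree d"
    unfolding n_def[symmetric] by (rule degree_le) (simp add: coeff_q)
  moreover have "pcompose q f = (\<Sum>i\<le>n. smult (c i) (f ^ i))"
    by (simp add: q_def pcompose_sum monom_altdef pcompose_smult pcompose_power pcompose_pCons)
  then have "pcompose q f = (\<Sum>i\<le>n. smult (c i) (f ^ i div d * d)) + (\<Sum>i\<le>n. smult (c i) (f ^ i mod d))"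
    by (simp flip: sum.distrib smult_add_right)
  then have "d dvd pcompose q f"
    using c by (auto intro!: dvd_sum dvd_smult)
  ultimately show ?thesis using that by blast
qed

text \<open>Take \<open>\<psi> = \<psi>\<^sub>1 \<circ> f\<close>, where \<open>\<psi>\<^sub>1\<close> comes from a \<open>q\<close> vanishing at the critical values of \<open>f\<close>; such a \<open>q\<close>
  exists with \<open>degree q < degree f\<close>.\<close>
lemma belyi_to_rational:
  fixes f :: "'a::field_char_0 poly"
  assumes "f \<noteq> 0"
  obtains \<psi> S N where "degree \<psi> > 0" "finite S" "pderiv \<psi> * f dvd (\<Prod>a\<in>S. \<psi> - [:a:]) ^ N"
  using assms
proof (induction "degree f" arbitrary: f thesis rule: less_induct)
  case less
  show ?case
  proof (cases "degree f = 0")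
    case True
    then obtain c where "f = [:c:]" by (rule degree_eq_zeroE)
    with less.prems(2) have "f dvd 1" by (simp add: is_unit_const_poly_iff dvd_field_iff)
    then show ?thesis
      by (intro less.prems(1)[of "[:0, 1:]" "{}" 0]) (simp_all add: pderiv_pCons)
  next
    case False
    then have "pderiv f \<noteq> 0" by (simp add: pderiv_eq_0_iff)
    then obtain q where q: "q \<noteq> 0" "degree q \<le> degree (pderiv f)" "pderiv f dvd pcompose q f"
      by (rule exists_dvd_pcompose)
    with False have "degree q < degree f"
      by (simp add: degree_pderiv)
    from less.hyps[OF this _ q(1)] obtain \<psi> S N where
      IH: "degree \<psi> > 0" "finite S" "pderiv \<psi> * q dvd (\<Prod>a\<in>S. \<psi> - [:a:]) ^ N"
      by blast
    define \<psi>' where "\<psi>' = pcompose \<psi> f"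
    \<comment> \<open>The value of \<open>\<psi>'\<close> at the roots of \<open>f\<close>: since
      \<open>x\<close> divides \<open>\<psi> - [:c:]\<close>, \<open>f\<close> divides
      \<open>\<psi>' - [:c:]\<close>. This absorbs the extra factor \<open>f\<close>.\<close>
    define c where "c = coeff \<psi> 0"
    let ?Q = "\<Prod>a\<in>insert c S. \<psi>' - [:a:]"
    have "pderiv \<psi>' * f = pcompose (pderiv \<psi>) f * pderiv f * f"
      by (simp add: \<psi>'_def pderiv_pcompose)
    also have "\<dots> dvd pcompose (pderiv \<psi>) f * pcompose q f * f"
      by (intro mult_dvd_mono q(3) dvd_refl)
    also have "\<dots> = pcompose (pderiv \<psi> * q) f * f"
      by (simp add: pcompose_mult)
    also have "\<dots> dvd pcompose ((\<Prod>a\<in>S. \<psi> - [:a:]) ^ N) f * f"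
      by (intro mult_dvd_mono pcompose_dvd IH dvd_refl)
    also have "\<dots> = (\<Prod>a\<in>S. \<psi>' - [:a:]) ^ N * f"
      by (simp add: pcompose_power pcompose_prod pcompose_diff \<psi>'_def)
    also have "\<dots> dvd (\<Prod>a\<in>S. \<psi>' - [:a:]) ^ N * (\<psi>' - [:c:])"
      by (intro mult_dvd_mono dvd_refl, cases \<psi>) (simp add: \<psi>'_def c_def pcompose_pCons)
    also have "(\<Prod>a\<in>S. \<psi>' - [:a:]) ^ N * (\<psi>' - [:c:]) dvd ?Q ^ N * ?Q"
      using IH(2) by (intro mult_dvd_mono dvd_power_same prod_dvd_prod_subset dvd_prodI) auto
    also have "\<dots> = ?Q ^ Suc N" by simp
    finally show ?thesis
      using IH False by (intro less.prems(1)[of \<psi>' "insert c S" "Suc N"])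
        (auto simp: \<psi>'_def degree_pcompose)
  qed
qed

section \<open>From finitely many rational points to 0 and 1\<close>

lemma rational_ratio:
  fixes u v :: rat
  assumes "u > 0" "v > 0"
  obtains m n :: nat where "of_nat (Suc m) * u = of_nat (Suc n) * v"
proof -
  obtain p q where pq: "quotient_of (v / u) = (p, q)" by (cases "quotient_of (v / u)")
  have q: "q > 0" using quotient_of_denom_pos[OF pq] .
  have vu: "v / u = of_int p / of_int q" using quotient_of_div[OF pq] .
  have "v / u > 0" using assms by simp
  with vu q have p: "p > 0" by (simp add: zero_less_divide_iff)
  have "of_int p * u = of_int q * v"
    using vu q assms by (simp add: field_simps)
  then show ?thesis
    using p q that[of "nat (p - 1)" "nat (q - 1)"] by simp
qed

text \<open>For \<open>a < b < c\<close> in \<open>S\<close>, the polynomial \<open>(x - a) ^ M * (x - c) ^ N\<close> with \<open>M * (c - b) = N * (b - a)\<close>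
  has critical points in \<open>{a, b, c}\<close> and identifies \<open>a\<close> with \<open>c\<close>, which shrinks \<open>S\<close>.\<close>
lemma belyi_of_rational:
  fixes S :: "rat set"
  assumes "finite S"
  obtains \<phi> N where "degree \<phi> > 0" "pderiv \<phi> * (\<Prod>a\<in>S. [:-a, 1:]) dvd (\<phi> * (\<phi> - 1)) ^ N"
  using assms
proof (induction "card S" arbitrary: S thesis rule: less_induct)
  case less
  show ?case
  proof (cases "card S \<le> 2")
    case True
    have "\<exists>a b. a \<noteq> b \<and> S \<subseteq> {a, b}"
    proof -
      consider "card S = 0" | "card S = 1" | "card S = 2" using True by linarith
      then show ?thesis
      proof cases
        case 1
        with less.prems have "S \<subseteq> {0, 1}" by auto
        then show ?thesis using zero_neq_one by blast
      next
        case 2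
        then obtain a where "S = {a}" by (auto simp: card_1_singleton_iff)
        then have "S \<subseteq> {a, a + 1}" "a \<noteq> a + 1" by auto
        then show ?thesis by blast
      next
        case 3
        then show ?thesis by (auto simp: card_2_iff)
      qed
    qed
    then obtain a b where ab: "a \<noteq> b" "S \<subseteq> {a, b}" by blast
    \<comment> \<open>The affine map that sends \<open>a\<close> to 0 and \<open>b\<close> to
      1.\<close>
    define k where "k = 1 / (b - a)"
    define \<phi> where "\<phi> = smult k [:-a, 1:]"
    have k: "k \<noteq> 0" "k * b - k * a = 1"
      using ab by (simp_all add: k_def flip: diff_divide_distrib)
    have 1: "\<phi> - 1 = smult k [:-b, 1:]"
      using k by (simp add: \<phi>_def one_pCons algebra_simps)
    have "pderiv \<phi> * (\<Prod>a\<in>S. [:-a, 1:]) dvd (\<Prod>a\<in>S. [:-a, 1:])"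
      using k by (simp add: \<phi>_def pderiv_smult pderiv_pCons smult_dvd)
    also have "\<dots> dvd (\<Prod>a\<in>{a, b}. [:-a, 1:])"
      using ab by (intro prod_dvd_prod_subset) auto
    also have "\<dots> dvd (\<phi> * (\<phi> - 1)) ^ 1"
      unfolding 1 using k ab by (simp add: \<phi>_def dvd_smult del: mult_pCons_left mult_pCons_right smult_pCons)
    finally show ?thesis
      using k by (intro less.prems(1)[of \<phi> 1]) (auto simp: \<phi>_def)
  next
    case False
    define a c where "a = Min S" and "c = Max S"
    have "S \<noteq> {}" using False by auto
    then have ac: "a \<in> S" "c \<in> S" using less.prems by (auto simp: a_def c_def)
    have "\<not> S \<subseteq> {a, c}"
    proof
      assume "S \<subseteq> {a, c}"
      then have "card S \<le> card {a, c}" by (intro card_mono) auto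
      also have "\<dots> \<le> 2" by (simp add: card_insert_if)
      finally show False using False by simp
    qed
    then obtain b where b: "b \<in> S" "b \<noteq> a" "b \<noteq> c" by auto
    have "a \<le> b" "b \<le> c"
      using b less.prems by (auto simp: a_def c_def)
    with b have abc: "a < b" "b < c" by auto
    then obtain m n :: nat where mn: "of_nat (Suc m) * (c - b) = of_nat (Suc n) * (b - a)"
      using rational_ratio[of "c - b" "b - a"] by auto
    define \<theta> where "\<theta> = [:-a, 1:] ^ Suc m * [:-c, 1:] ^ Suc n"
    define P where "P = (\<Prod>a\<in>S. [:-a, 1:])"
    let ?\<theta> = "\<lambda>x. poly \<theta> x"
    \<comment> \<open>Apart from \<open>a\<close> and \<open>c\<close>, the only critical point of
      \<open>\<theta>\<close> is the weighted mean of \<open>c\<close> and \<open>a\<close> with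
      weights \<open>m + 1\<close> and \<open>n + 1\<close>; the choice of \<open>m\<close> and
      \<open>n\<close> places it at \<open>b\<close>.\<close>
    define l where "l = (of_nat (Suc m) + of_nat (Suc n) :: rat)"
    have l: "of_nat (Suc m) * c + of_nat (Suc n) * a = l * b" "l \<noteq> 0"
      using mn unfolding l_def by (simp_all add: algebra_simps add_eq_0_iff)
    have "pderiv \<theta> = [:-a, 1:] ^ m * [:-c, 1:] ^ n *
        (smult (of_nat (Suc m)) [:-c, 1:] + smult (of_nat (Suc n)) [:-a, 1:])"
      unfolding \<theta>_def pderiv_mult pderiv_power_Suc
      by (simp add: pderiv_pCons algebra_simps flip: one_pCons del: of_nat_Suc mult_pCons_left mult_pCons_right smult_pCons)
    also have "smult (of_nat (Suc m)) [:-c, 1:] + smult (of_nat (Suc n)) [:-a, 1:] = smult l [:-b, 1:]"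
      using l by (simp add: l_def)
    also have "[:-a, 1:] ^ m * [:-c, 1:] ^ n * smult l [:-b, 1:] dvd P ^ m * P ^ n * P"
      using ac b less.prems l(2)
      by (intro mult_dvd_mono dvd_power_same smult_dvd) (auto simp: P_def intro!: dvd_prodI)
    finally have d\<theta>: "pderiv \<theta> dvd P ^ m * P ^ n * P" .
    let ?S' = "?\<theta> ` S"
    let ?R = "\<Prod>b\<in>?S'. [:-b, 1:]"
    have fin: "finite S" by fact
    \<comment> \<open>Distinct points of \<open>S\<close> may share a value under
      \<open>\<theta>\<close>, so the linear factors are matched one by one, at the price of the
      exponent \<open>card S\<close>.\<close>
    have "P dvd (\<Prod>a\<in>S. pcompose ?R \<theta>)"
      unfolding P_def
    proof (rule prod_dvd_prod)
      fix a assume "a \<in> S"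
      have "poly (\<theta> - [:?\<theta> a:]) a = 0" by simp
      then have "[:-a, 1:] dvd \<theta> - [:?\<theta> a:]" by (simp only: poly_eq_0_iff_dvd)
      also have "\<dots> = pcompose [:-?\<theta> a, 1:] \<theta>" by (simp add: pcompose_pCons)
      also have "\<dots> dvd pcompose ?R \<theta>"
        using \<open>a \<in> S\<close> fin by (intro pcompose_dvd dvd_prodI) auto
      finally show "[:-a, 1:] dvd pcompose ?R \<theta>" .
    qed
    then have P: "P dvd pcompose ?R \<theta> ^ card S" by simp
    have "?S' \<subseteq> ?\<theta> ` (S - {c})"
    proof -
      have "?\<theta> c = ?\<theta> a" by (simp add: \<theta>_def)
      then have "?\<theta> x \<in> ?\<theta> ` (S - {c})" if "x \<in> S" for x
        using that ac abc by (cases "x = c") auto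
      then show ?thesis by auto
    qed
    then have "card ?S' \<le> card (?\<theta> ` (S - {c}))" using fin by (intro card_mono) auto
    also have "\<dots> \<le> card (S - {c})" using fin by (intro card_image_le) auto
    also have "\<dots> < card S" using ac fin by (intro psubset_card_mono) auto
    finally have "card ?S' < card S" .
    from less.hyps[OF this] fin obtain \<chi> N where
      IH: "degree \<chi> > 0" "pderiv \<chi> * ?R dvd (\<chi> * (\<chi> - 1)) ^ N" by blast
    define \<phi> where "\<phi> = pcompose \<chi> \<theta>"
    \<comment> \<open>A common exponent for both factors: large enough for the power of
      \<open>pcompose ?R \<theta>\<close>, and positive for the single factor
      \<open>pcompose (pderiv \<chi>) \<theta>\<close>.\<close>
    define K where "K = Suc (card S * (m + n + 2))"
    have "pderiv \<phi> * P dvd pcompose (pderiv \<chi>) \<theta> * (P ^ m * P ^ n * P) * P"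
      unfolding \<phi>_def pderiv_pcompose by (intro mult_dvd_mono d\<theta> dvd_refl)
    also have "\<dots> = pcompose (pderiv \<chi>) \<theta> * P ^ (m + n + 2)"
      by (simp add: power_add power2_eq_square mult_ac)
    also have "\<dots> dvd pcompose (pderiv \<chi>) \<theta> ^ K * (pcompose ?R \<theta> ^ card S) ^ (m + n + 2)"
      by (intro mult_dvd_mono dvd_power_same P dvd_power) (simp add: K_def)
    also have "\<dots> dvd pcompose (pderiv \<chi>) \<theta> ^ K * pcompose ?R \<theta> ^ K"
      unfolding power_mult[symmetric] K_def by (intro mult_dvd_mono dvd_refl le_imp_power_dvd) auto
    also have "\<dots> = pcompose ((pderiv \<chi> * ?R) ^ K) \<theta>"
      by (simp add: pcompose_mult pcompose_power power_mult_distrib)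
    also have "\<dots> dvd pcompose (((\<chi> * (\<chi> - 1)) ^ N) ^ K) \<theta>"
      by (intro pcompose_dvd dvd_power_same IH)
    also have "\<dots> = (\<phi> * (\<phi> - 1)) ^ (N * K)"
      by (simp add: \<phi>_def pcompose_mult pcompose_power pcompose_diff pcompose_1 power_mult)
    finally have "pderiv \<phi> * P dvd (\<phi> * (\<phi> - 1)) ^ (N * K)" .
    moreover have "degree \<theta> = Suc m + Suc n"
      unfolding \<theta>_def by (subst degree_mult_eq) (simp_all add: degree_power_eq del: power_Suc)
    then have "degree \<phi> > 0"
      using IH by (simp add: \<phi>_def degree_pcompose)
    ultimately show ?thesis
      using less.prems(1) by (auto simp: P_def)
  qed
qed

text \<open>\<open>\<psi>\<close> moves the roots of \<open>f\<close> and its own critical points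
  into a rational set \<open>S\<close>; \<open>\<chi>\<close> then moves \<open>S\<close> and its
  own critical points into 0 and 1. The chain rule makes \<open>pcompose \<chi> \<psi>\<close> do
  both.\<close>

lemma exists_belyi_poly:
  fixes f :: "rat poly"
  assumes "f \<noteq> 0"
  obtains \<phi> N where "degree \<phi> > 0" "pderiv \<phi> * f dvd (\<phi> * (\<phi> - 1)) ^ N"
proof -
  from assms obtain \<psi> S N where \<psi>:
    "degree \<psi> > 0" "finite S" "pderiv \<psi> * f dvd (\<Prod>a\<in>S. \<psi> - [:a:]) ^ N"
    by (rule belyi_to_rational)
  from \<psi>(2) obtain \<chi> M where \<chi>:
    "degree \<chi> > 0" "pderiv \<chi> * (\<Prod>a\<in>S. [:-a, 1:]) dvd (\<chi> * (\<chi> - 1)) ^ M"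
    by (rule belyi_of_rational)
  define \<phi> where "\<phi> = pcompose \<chi> \<psi>"
  define T where "T = (\<Prod>a\<in>S. [:-a, 1:])"
  have T: "(\<Prod>a\<in>S. \<psi> - [:a:]) = pcompose T \<psi>"
    by (simp add: T_def pcompose_prod pcompose_pCons diff_conv_add_uminus add.commute del: add_uminus_conv_diff)
  have "pderiv \<phi> * f = pcompose (pderiv \<chi>) \<psi> * (pderiv \<psi> * f)"
    by (simp add: \<phi>_def pderiv_pcompose mult_ac)
  also have "\<dots> dvd pcompose (pderiv \<chi>) \<psi> ^ Suc N * pcompose T \<psi> ^ Suc N"
    using \<psi>(3) unfolding T by (intro mult_dvd_mono) (auto intro: dvd_trans le_imp_power_dvd)
  also have "\<dots> = pcompose ((pderiv \<chi> * T) ^ Suc N) \<psi>"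
    by (simp only: pcompose_mult pcompose_power power_mult_distrib)
  also have "\<dots> dvd pcompose (((\<chi> * (\<chi> - 1)) ^ M) ^ Suc N) \<psi>"
    using \<chi>(2) unfolding T_def by (intro pcompose_dvd dvd_power_same)
  also have "\<dots> = (\<phi> * (\<phi> - 1)) ^ (M * Suc N)"
    by (simp only: \<phi>_def pcompose_mult pcompose_power pcompose_diff pcompose_1 power_mult)
  finally show ?thesis
    using \<psi>(1) \<chi>(1) by (intro that[of \<phi> "M * Suc N"]) (simp_all add: \<phi>_def degree_pcompose)
qed

section \<open>Multiplicities of zeros and squarefree parts\<close>

lemma prime_elem_poly_not_dvd_pderiv:
  fixes P :: "'a::field_char_0 poly"
  assumes "prime_elem P"
  shows "\<not> P dvd pderiv P"
  using assms by (auto simp: prime_elem_def is_unit_iff_degree)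

text \<open>Differentiation in characteristic 0 lowers the order of a zero by exactly one. With
  \<open>W = P ^ (k + 1) * V\<close>, the only term of the derivative without an evident factor
  \<open>P ^ (k + 1)\<close> is \<open>(k + 1) * P ^ k * V * pderiv P\<close>, which forces
  \<open>P dvd V\<close>.\<close>

lemma prime_power_dvd_of_dvd_pderiv:
  fixes P W :: "'a::field_char_0 poly"
  assumes P: "prime_elem P" and "P dvd W" "P ^ k dvd pderiv W"
  shows "P ^ Suc k dvd W"
  using assms(3)
proof (induction k)
  case 0
  then show ?case using assms(2) by simp
next
  case (Suc k)
  then have "P ^ Suc k dvd W"
    using le_imp_power_dvd[of k "Suc k" P] dvd_trans by auto
  then obtain V where V: "W = P ^ Suc k * V" by (elim dvdE)
  have "pderiv W = P ^ k * (P * pderiv V + V * smult (of_nat (Suc k)) (pderiv P))"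
    unfolding V pderiv_mult pderiv_power_Suc by (simp add: algebra_simps del: of_nat_Suc)
  with Suc.prems have "P dvd P * pderiv V + V * smult (of_nat (Suc k)) (pderiv P)"
    using P by (simp add: mult_ac prime_elem_def del: of_nat_Suc)
  then have "P dvd V * smult (of_nat (Suc k)) (pderiv P)"
    by (simp add: dvd_add_right_iff del: of_nat_Suc)
  then have "P dvd V * pderiv P"
    by (simp add: dvd_smult_iff del: of_nat_Suc)
  then have "P dvd V"
    using P prime_elem_poly_not_dvd_pderiv[OF P] by (auto simp: prime_elem_dvd_mult_iff)
  then show ?case by (simp add: V mult_dvd_mono mult.commute)
qed

text \<open>Each prime factor of \<open>A\<close>, counted with multiplicity, costs one factor
  \<open>B\<close>. This turns an inclusion of zero sets into a divisibility that can be evaluated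
  at integers.\<close>

lemma dvd_power_of_prime_dvd:
  fixes A B :: "'a::factorial_semiring"
  assumes "A \<noteq> 0" and "\<And>p. prime p \<Longrightarrow> p dvd A \<Longrightarrow> p dvd B"
  obtains N where "A dvd B ^ N"
proof -
  have "\<exists>N. A dvd B ^ N"
    using assms
  proof (induction A rule: prime_divisors_induct)
    case zero
    then show ?case by simp
  next
    case (unit x)
    then show ?case by (auto intro: unit_imp_dvd)
  next
    case (factor p x)
    then obtain N where "x dvd B ^ N" by auto
    moreover have "p dvd B" using factor by auto
    ultimately have "p * x dvd B ^ Suc N" by (simp add: mult_dvd_mono)
    then show ?case by blast
  qed
  then show ?thesis using that by blast
qed

text \<open>A zero of \<open>\<Phi> = \<phi> * (\<phi> - 1)\<close> of multiplicity \<open>m\<close> is a zero of \<open>\<phi>'\<close> of multiplicity \<open>m - 1\<close>, so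
  \<open>\<Phi> / \<phi>'\<close> has the zeros of \<open>\<Phi>\<close>, each once.\<close>
lemma exists_squarefree_belyi_poly:
  fixes f :: "rat poly"
  assumes f: "f \<noteq> 0" and sqf: "\<And>P. prime P \<Longrightarrow> \<not> P ^ 2 dvd f"
  obtains \<phi> h N where "degree \<phi> > 0" "h \<noteq> 0" "degree f + degree h = degree \<phi> + 1"
    "\<phi> * (\<phi> - 1) dvd (f * h) ^ N"
proof -
  from f obtain \<phi> N where \<phi>: "degree \<phi> > 0" "pderiv \<phi> * f dvd (\<phi> * (\<phi> - 1)) ^ N"
    by (rule exists_belyi_poly)
  define \<Phi> where "\<Phi> = \<phi> * (\<phi> - 1)"
  have deg1: "degree (\<phi> - 1) = degree \<phi>"
    using \<phi>(1) degree_add_eq_left[of "- 1" \<phi>] by simp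
  have [simp]: "\<phi> \<noteq> 0" "\<phi> \<noteq> 1" "pderiv \<phi> \<noteq> 0"
    using \<phi>(1) by (auto simp: pderiv_eq_0_iff)
  then have [simp]: "\<Phi> \<noteq> 0" by (simp add: \<Phi>_def)
  have deg\<Phi>: "degree \<Phi> = 2 * degree \<phi>"
    unfolding \<Phi>_def by (subst degree_mult_eq) (simp_all add: deg1)
  have d\<Phi>: "pderiv \<phi> dvd pderiv \<Phi>"
    by (simp add: \<Phi>_def pderiv_mult pderiv_diff)
  \<comment> \<open>The relation for \<open>\<phi>\<close> only shows that each prime of the left
    side divides \<open>\<Phi>\<close>. The multiplicity follows because \<open>\<Phi>\<close> has
    one more factor \<open>P\<close> than \<open>pderiv \<phi>\<close>, and \<open>f\<close> has at
    most one.\<close>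
  have "pderiv \<phi> * f dvd \<Phi>"
  proof (rule multiplicity_le_imp_dvd)
    show "pderiv \<phi> * f \<noteq> 0" using f by simp
    fix P :: "rat poly" assume P: "prime P"
    define k where "k = multiplicity P (pderiv \<phi>)"
    have mult: "multiplicity P (pderiv \<phi> * f) = k + multiplicity P f"
      using P f by (simp add: k_def prime_elem_multiplicity_mult_distrib)
    have "\<not> is_unit P" using P by auto
    then have "multiplicity P f < 2"
      using sqf[OF P] f by (intro multiplicity_lessI) auto
    show "multiplicity P (pderiv \<phi> * f) \<le> multiplicity P \<Phi>"
    proof (cases "P dvd pderiv \<phi> * f")
      case True
      then have "P dvd \<Phi>"
        using \<phi>(2) P unfolding \<Phi>_def[symmetric] by (metis dvd_trans prime_dvd_power)
      moreover have "P ^ k dvd pderiv \<Phi>"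
        using d\<Phi> multiplicity_dvd dvd_trans unfolding k_def by blast
      ultimately have "P ^ Suc k dvd \<Phi>"
        using P by (intro prime_power_dvd_of_dvd_pderiv) auto
      then have "Suc k \<le> multiplicity P \<Phi>"
        using \<open>\<not> is_unit P\<close> by (intro multiplicity_geI) auto
      then show ?thesis
        using mult \<open>multiplicity P f < 2\<close> by simp
    qed (simp add: not_dvd_imp_multiplicity_0)
  qed
  then obtain h where h: "\<Phi> = pderiv \<phi> * f * h" by (elim dvdE)
  have "h \<noteq> 0" using h by auto
  \<comment> \<open>Otherwise \<open>\<Phi>\<close> and \<open>pderiv \<phi>\<close> would contain
    \<open>P\<close> equally often, against the gain of one factor over the derivative.\<close>
  have "P dvd f * h" if P: "prime P" and "P dvd \<Phi>" for P
  proof (rule ccontr)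
    assume nd: "\<not> P dvd f * h"
    define k where "k = multiplicity P \<Phi>"
    have "multiplicity P \<Phi> = multiplicity P (pderiv \<phi>) + multiplicity P (f * h)"
      using P f \<open>h \<noteq> 0\<close> by (simp add: h mult.assoc prime_elem_multiplicity_mult_distrib)
    then have "k = multiplicity P (pderiv \<phi>)"
      using nd by (simp add: k_def not_dvd_imp_multiplicity_0)
    then have "P ^ k dvd pderiv \<Phi>"
      using d\<Phi> multiplicity_dvd dvd_trans by blast
    then have "P ^ Suc k dvd \<Phi>"
      using P \<open>P dvd \<Phi>\<close> by (intro prime_power_dvd_of_dvd_pderiv) auto
    then have "Suc k \<le> multiplicity P \<Phi>"
      using P by (intro multiplicity_geI) auto
    then show False by (simp add: k_def)
  qed
  then obtain M where M: "\<Phi> dvd (f * h) ^ M"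
    using dvd_power_of_prime_dvd[of \<Phi> "f * h"] by auto
  have "degree \<Phi> = degree \<phi> - 1 + degree f + degree h"
    unfolding h using f \<open>h \<noteq> 0\<close> by (simp add: degree_mult_eq degree_pderiv)
  then have "degree f + degree h = degree \<phi> + 1"
    using deg\<Phi> \<phi>(1) by simp
  then show ?thesis
    using that[of \<phi> h M] \<phi>(1) \<open>h \<noteq> 0\<close> M by (simp add: \<Phi>_def)
qed

section \<open>Separability over the complex numbers and square factors over the rationals\<close>

lemma map_poly_of_rat_mult: "map_poly of_rat (p * q) = map_poly of_rat p * map_poly of_rat q"
  by (intro poly_eqI) (simp add: coeff_map_poly coeff_mult of_rat_sum of_rat_mult)

text \<open>A complex root of \<open>P\<close> would be a common root of \<open>f\<close> and its
  derivative.\<close>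

lemma separable_imp_prime_square_not_dvd:
  assumes "separable_int_poly f" "prime P"
  shows "\<not> P ^ 2 dvd map_poly rat_of_int f"
proof
  assume "P ^ 2 dvd map_poly rat_of_int f"
  then obtain Q where Q: "map_poly rat_of_int f = P ^ 2 * Q" by (elim dvdE)
  define c where "c = (map_poly of_rat :: rat poly \<Rightarrow> complex poly)"
  have "map_poly of_int f = c (map_poly rat_of_int f)"
    by (simp add: c_def map_poly_map_poly o_def)
  also have "\<dots> = c P * (c P * c Q)"
    by (simp add: Q c_def map_poly_of_rat_mult power2_eq_square mult_ac)
  finally have eq: "map_poly of_int f = c P * (c P * c Q)" .
  have "P \<noteq> 0" "\<not> is_unit P" using assms(2) by auto
  then have "degree P \<noteq> 0" by (simp add: is_unit_iff_degree)
  then have "degree (c P) \<noteq> 0" by (simp add: c_def degree_map_poly)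
  then have "\<not> constant (poly (c P))" by (simp add: constant_degree)
  then obtain z where "poly (c P) z = 0" using fundamental_theorem_of_algebra by blast
  then have "poly (map_poly of_int f) z = 0" "poly (pderiv (map_poly of_int f)) z = 0"
    unfolding eq by (simp_all add: pderiv_mult)
  then show False
    using assms(1) unfolding separable_int_poly_def rsquarefree_roots by blast
qed

section \<open>Integer values and the ABC conjecture\<close>

lemma poly_map_of_int:
  "poly (map_poly of_int p) (of_int x) = (of_int (poly p x) :: 'a::comm_ring_1)"
  by (induction p) (simp_all add: map_poly_pCons)

lemma clear_denominators:
  fixes p :: "rat poly"
  obtains c :: nat and q :: "int poly" where "c > 0" "map_poly of_int q = smult (of_nat c) p"
proof -
  have "\<exists>c q. c > 0 \<and> map_poly of_int q = smult (of_nat c) p"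
  proof (induction p)
    case 0
    have "map_poly of_int 0 = smult (of_nat 1) (0 :: rat poly)" by simp
    then show ?case using zero_less_one by blast
  next
    case (pCons a p)
    then obtain c q where c: "c > 0" "map_poly of_int q = smult (of_nat c) p" by blast
    obtain r s where rs: "quotient_of a = (r, s)" by (cases "quotient_of a")
    have s: "s > 0" using quotient_of_denom_pos[OF rs] .
    have a: "a = of_int r / of_int s" using quotient_of_div[OF rs] .
    have "map_poly of_int (pCons (r * int c) (smult s q)) = smult (of_nat (nat s * c)) (pCons a p)"
      using s c a by (simp add: map_poly_pCons map_poly_smult)
    moreover have "nat s * c > 0" using s c by simp
    ultimately show ?case by blast
  qed
  then show ?thesis using that by blast
qed

text \<open>Here \<open>P / M\<close> is the rational polynomial \<open>\<phi>\<close> and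
  \<open>H\<close> a multiple of its cofactor \<open>h\<close>. Primes dividing \<open>P x\<close>
  or \<open>P x - M\<close> can thus only come from \<open>K\<close>, \<open>f x\<close> and
  \<open>H x\<close>.\<close>

lemma exists_integral_belyi_poly:
  fixes f :: "int poly"
  assumes "separable_int_poly f"
  obtains P H :: "int poly" and M K N :: nat where
    "degree P > 0" "H \<noteq> 0" "degree f + degree H = degree P + 1" "M > 0" "K > 0"
    "\<And>x. poly P x * (poly P x - int M) dvd int K * (poly f x * poly H x) ^ N"
proof -
  let ?r = "map_poly rat_of_int"
  have "f \<noteq> 0" using assms by (auto simp: separable_int_poly_def rsquarefree_def)
  then have "?r f \<noteq> 0" by (simp add: map_poly_eq_0_iff)
  with separable_imp_prime_square_not_dvd[OF assms] obtain \<phi> h N where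
    \<phi>: "degree \<phi> > 0" "h \<noteq> 0" "degree (?r f) + degree h = degree \<phi> + 1"
      "\<phi> * (\<phi> - 1) dvd (?r f * h) ^ N"
    using exists_squarefree_belyi_poly by blast
  then obtain R where R: "(?r f * h) ^ N = \<phi> * (\<phi> - 1) * R" by (elim dvdE)
  obtain M P where P: "M > 0" "?r P = smult (of_nat M) \<phi>" by (rule clear_denominators)
  obtain c H where H: "c > 0" "?r H = smult (of_nat c) h" by (rule clear_denominators)
  obtain e Q where Q: "e > 0" "?r Q = smult (of_nat e) R" by (rule clear_denominators)
  have "degree (?r P) = degree \<phi>" "degree (?r H) = degree h"
    using P H by simp_all
  then have deg: "degree P = degree \<phi>" "degree H = degree h" "degree (?r f) = degree f"
    by (simp_all add: degree_map_poly)
  have "?r H \<noteq> 0" using H \<phi> by simp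
  then have "H \<noteq> 0" by auto
  \<comment> \<open>\<open>M ^ 2\<close> comes from \<open>\<phi>\<close> and
    \<open>\<phi> - 1\<close>, \<open>e\<close> from the quotient \<open>R\<close>; the power of
    \<open>c\<close> on the left makes up for writing \<open>H\<close> instead of \<open>h\<close>
    on the right.\<close>
  have "poly P x * (poly P x - int M) * (poly Q x * int c ^ N) =
        int (M ^ 2 * e) * (poly f x * poly H x) ^ N" for x
  proof -
    let ?x = "rat_of_int x"
    have Px: "of_int (poly P x) = of_nat M * poly \<phi> ?x"
      using P by (simp flip: poly_map_of_int)
    have Hx: "of_int (poly H x) = of_nat c * poly h ?x"
      using H by (simp flip: poly_map_of_int)
    have Qx: "of_int (poly Q x) = of_nat e * poly R ?x"
      using Q by (simp flip: poly_map_of_int)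
    have Rx: "(of_int (poly f x) * poly h ?x) ^ N = poly \<phi> ?x * (poly \<phi> ?x - 1) * poly R ?x"
      using arg_cong[OF R, of "\<lambda>p. poly p ?x"] by (simp add: poly_map_of_int)
    have "rat_of_int (poly P x * (poly P x - int M) * (poly Q x * int c ^ N)) =
      of_nat M ^ 2 * of_nat e * of_nat c ^ N * (poly \<phi> ?x * (poly \<phi> ?x - 1) * poly R ?x)"
      by (simp add: Px Qx algebra_simps power2_eq_square)
    also have "\<dots> = rat_of_int (int (M ^ 2 * e) * (poly f x * poly H x) ^ N)"
      by (simp add: Hx flip: Rx) (simp add: power_mult_distrib)
    finally show ?thesis by (simp only: of_int_eq_iff)
  qed
  then have "poly P x * (poly P x - int M) dvd int (M ^ 2 * e) * (poly f x * poly H x) ^ N" for x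
    by (metis dvd_triv_left)
  then show ?thesis
    using that[of P H M "M ^ 2 * e" N] \<phi> P Q \<open>H \<noteq> 0\<close> deg by simp
qed

section \<open>Radicals of natural numbers\<close>

lemma prod_prime_factors_dvd: "n > 0 \<Longrightarrow> \<Prod>(prime_factors n) dvd n" for n :: nat
proof -
  assume "n > 0"
  have "(\<Prod>p\<in>prime_factors n. p) dvd (\<Prod>p\<in>prime_factors n. p ^ multiplicity p n)"
    by (intro prod_dvd_prod dvd_power) (auto simp: prime_factors_multiplicity)
  then show ?thesis using \<open>n > 0\<close> by (simp add: prod_prime_factors)
qed

text \<open>Every prime exponent in \<open>n\<close> is at least 2. This is the source of the square
  root saving for the radical of \<open>f x\<close>.\<close>

lemma prod_prime_factors_square_dvd:
  fixes n :: nat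
  assumes "n > 0" and powerful: "\<And>p. prime p \<Longrightarrow> p dvd n \<Longrightarrow> p ^ 2 dvd n"
  shows "\<Prod>(prime_factors n) ^ 2 dvd n"
proof -
  have "(\<Prod>p\<in>prime_factors n. p ^ 2) dvd (\<Prod>p\<in>prime_factors n. p ^ multiplicity p n)"
  proof (intro prod_dvd_prod le_imp_power_dvd multiplicity_geI)
    fix p assume p: "p \<in> prime_factors n"
    then show "p ^ 2 dvd n" using powerful by (auto simp: in_prime_factors_iff)
    show "\<not> is_unit p" using p by (auto simp: in_prime_factors_iff)
  qed (use assms in auto)
  then show ?thesis using assms(1) by (simp add: prod_prime_factors prod_power_distrib)
qed

text \<open>The primes of \<open>a\<close> outside \<open>b\<close> lie in \<open>c\<close>. The
  bound is asymmetric because it is meant for a \<open>b\<close> with small radical and a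
  \<open>c\<close> that is estimated by its size.\<close>

lemma prod_prime_factors_le_mult:
  fixes a b c :: nat
  assumes "b > 0" "c > 0" and "\<And>p. prime p \<Longrightarrow> p dvd a \<Longrightarrow> p dvd b * c"
  shows "\<Prod>(prime_factors a) \<le> \<Prod>(prime_factors b) * c"
proof -
  have pos: "\<Prod>A > 0" if "A \<subseteq> prime_factors n" for A and n :: nat
    using that by (intro prod_pos) (auto simp: in_prime_factors_iff prime_gt_0_nat dest!: subsetD)
  have sub: "prime_factors a - prime_factors b \<subseteq> prime_factors c"
  proof
    fix p assume "p \<in> prime_factors a - prime_factors b"
    then have "prime p" "p dvd a" "\<not> p dvd b"
      using assms(1) by (auto simp: in_prime_factors_iff)
    then show "p \<in> prime_factors c"
      using assms(2) assms(3)[of p] by (auto simp: in_prime_factors_iff prime_dvd_mult_iff)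
  qed
  have "\<Prod>(prime_factors a) = \<Prod>(prime_factors a \<inter> prime_factors b) * \<Prod>(prime_factors a - prime_factors b)"
    by (simp add: prod.Int_Diff)
  also have "\<dots> dvd \<Prod>(prime_factors b) * \<Prod>(prime_factors c)"
    using sub by (intro mult_dvd_mono prod_dvd_prod_subset) auto
  also have "\<dots> dvd \<Prod>(prime_factors b) * c"
    using assms by (intro mult_dvd_mono prod_prime_factors_dvd) auto
  finally show ?thesis
    using pos[of "prime_factors b" b] assms by (intro dvd_imp_le) auto
qed

lemma prod_prime_factors_mono:
  fixes a b :: nat
  assumes "a dvd b" "b > 0"
  shows "\<Prod>(prime_factors a) \<le> \<Prod>(prime_factors b)"
  using prod_prime_factors_le_mult[of b 1 a] assms by (auto intro: dvd_trans)

text \<open>Dividing the triple by \<open>gcd u m\<close> costs a factor of at most \<open>m\<close>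
  and does not increase the radical. In the application \<open>m\<close> is a fixed denominator, so
  the loss is a constant.\<close>

lemma ABC_without_coprimality:
  assumes ABC_Conjecture "\<epsilon> > 0"
  obtains C :: real where "C > 0"
    "\<And>u m :: nat. u > 0 \<Longrightarrow> m > 0 \<Longrightarrow>
       real (u + m) \<le> real m * C * real (abc_N u m (u + m)) powr (1 + \<epsilon>)"
proof -
  from assms obtain C where C: "\<And>a b c :: nat. a > 0 \<Longrightarrow> b > 0 \<Longrightarrow> c > 0 \<Longrightarrow>
      Gcd {a, b, c} = 1 \<Longrightarrow> a + b = c \<Longrightarrow> real c \<le> C * real (abc_N a b c) powr (1 + \<epsilon>)"
    unfolding ABC_Conjecture_def by meson
  have "real (u + m) \<le> real m * max C 1 * real (abc_N u m (u + m)) powr (1 + \<epsilon>)"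
    if um: "u > 0" "m > 0" for u m :: nat
  proof -
    define g where "g = gcd u m"
    have "g > 0" using um by (simp add: g_def)
    obtain u' m' where u'm': "u = u' * g" "m = m' * g" "coprime u' m'"
      using gcd_coprime_exists[of u m] um unfolding g_def by auto
    have pos: "u' > 0" "m' > 0" using u'm' um by (auto intro: Nat.gr0I)
    let ?r = "\<lambda>u m. real (abc_N u m (u + m)) powr (1 + \<epsilon>)"
    have "gcd u' (gcd m' (u' + m')) = 1"
      using u'm'(3) by (simp flip: gcd.assoc add: coprime_iff_gcd_eq_1)
    then have "real (u' + m') \<le> C * ?r u' m'"
      using pos by (intro C) auto
    also have "\<dots> \<le> max C 1 * ?r u m"
    proof (intro mult_mono powr_mono2)
      have "u' * m' * (u' + m') dvd u * m * (u + m)"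
        unfolding u'm'(1,2) by (intro mult_dvd_mono) (auto simp flip: distrib_right)
      then show "real (abc_N u' m' (u' + m')) \<le> real (abc_N u m (u + m))"
        using um unfolding abc_N_def of_nat_le_iff by (intro prod_prime_factors_mono) auto
    qed (use assms in auto)
    finally have "real g * real (u' + m') \<le> real g * (max C 1 * ?r u m)"
      using \<open>g > 0\<close> by (intro mult_left_mono) auto
    also have "\<dots> \<le> real m * (max C 1 * ?r u m)"
      using um by (intro mult_right_mono) (auto simp: g_def intro: gcd_le2_nat)
    finally show ?thesis
      by (simp add: u'm' algebra_simps)
  qed
  then show ?thesis using that[of "max C 1"] by auto
qed

section \<open>Growth of integer polynomials\<close>

lemma poly_abs_upper_bound:
  fixes p :: "int poly"
  obtains B :: real where "B > 0"
    "\<And>x. \<bar>x\<bar> \<ge> 1 \<Longrightarrow> \<bar>real_of_int (poly p x)\<bar> \<le> B * \<bar>real_of_int x\<bar> ^ degree p"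
proof -
  \<comment> \<open>The summand 1 keeps \<open>B\<close> positive when \<open>p = 0\<close>.\<close>
  define B where "B = 1 + (\<Sum>i\<le>degree p. \<bar>real_of_int (coeff p i)\<bar>)"
  have "\<bar>real_of_int (poly p x)\<bar> \<le> B * \<bar>real_of_int x\<bar> ^ degree p" if "\<bar>x\<bar> \<ge> 1" for x
  proof -
    have x: "\<bar>real_of_int x\<bar> \<ge> 1" using that by linarith
    have "\<bar>real_of_int (poly p x)\<bar> \<le> (\<Sum>i\<le>degree p. \<bar>real_of_int (coeff p i * x ^ i)\<bar>)"
      unfolding poly_altdef of_int_sum by (rule sum_abs)
    also have "\<dots> \<le> (\<Sum>i\<le>degree p. \<bar>real_of_int (coeff p i)\<bar> * \<bar>real_of_int x\<bar> ^ degree p)"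
      using x by (intro sum_mono) (auto simp: abs_mult power_abs intro!: mult_left_mono power_increasing)
    also have "\<dots> \<le> B * \<bar>real_of_int x\<bar> ^ degree p"
      by (simp add: B_def distrib_right flip: sum_distrib_right)
    finally show ?thesis .
  qed
  moreover have "B > 0" unfolding B_def by (simp add: add_pos_nonneg sum_nonneg)
  ultimately show ?thesis using that by blast
qed

text \<open>A nonzero integer leading coefficient has absolute value at least 1, and the lower terms
  amount to at most half of \<open>\<bar>x\<bar> ^ degree p\<close> once
  \<open>\<bar>x\<bar> \<ge> 2 * B\<close>.\<close>

lemma poly_abs_lower_bound:
  fixes p :: "int poly"
  assumes "degree p > 0"
  obtains X :: real where
    "\<And>x. \<bar>real_of_int x\<bar> \<ge> X \<Longrightarrow> \<bar>real_of_int (poly p x)\<bar> \<ge> \<bar>real_of_int x\<bar> ^ degree p / 2"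
proof -
  define l where "l = lead_coeff p"
  define q where "q = p - monom l (degree p)"
  have "p \<noteq> 0" using assms by auto
  then have "\<bar>l\<bar> \<ge> 1" unfolding l_def by (simp add: int_one_le_iff_zero_less)
  have deg: "degree q \<le> degree p - 1"
    unfolding q_def l_def by (intro degree_le) (auto simp: coeff_eq_0 not_less dest: le_neq_implies_less)
  obtain B where B: "B > 0"
    "\<And>x. \<bar>x\<bar> \<ge> 1 \<Longrightarrow> \<bar>real_of_int (poly q x)\<bar> \<le> B * \<bar>real_of_int x\<bar> ^ degree q"
    by (rule poly_abs_upper_bound[of q]) blast
  have "\<bar>real_of_int (poly p x)\<bar> \<ge> \<bar>real_of_int x\<bar> ^ degree p / 2"
    if x: "\<bar>real_of_int x\<bar> \<ge> max 1 (2 * B)" for x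
  proof -
    define t where "t = \<bar>real_of_int x\<bar>"
    have t: "t \<ge> 1" "t \<ge> 2 * B" using x by (auto simp: t_def)
    have "\<bar>real_of_int (poly q x)\<bar> \<le> B * t ^ degree q"
      using B(2)[of x] t unfolding t_def by linarith
    also have "\<dots> \<le> t / 2 * t ^ (degree p - 1)"
      using t deg B by (intro mult_mono power_increasing) auto
    also have "\<dots> = t ^ degree p / 2"
      using assms by (cases "degree p") auto
    finally have q: "\<bar>real_of_int (poly q x)\<bar> \<le> t ^ degree p / 2" .
    have "poly p x = l * x ^ degree p + poly q x"
      by (simp add: q_def poly_monom)
    moreover have "\<bar>real_of_int (l * x ^ degree p)\<bar> \<ge> t ^ degree p"
      using \<open>\<bar>l\<bar> \<ge> 1\<close> mult_right_mono[of 1 "\<bar>real_of_int l\<bar>" "t ^ degree p"]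
      by (simp add: t_def abs_mult power_abs)
    ultimately show ?thesis using q unfolding t_def[symmetric] of_int_add by linarith
  qed
  then show ?thesis using that by blast
qed

lemma finite_bounded_ints: "finite {x::int. \<bar>real_of_int x\<bar> \<le> L}"
proof (rule finite_subset)
  show "{x::int. \<bar>real_of_int x\<bar> \<le> L} \<subseteq> {-\<lceil>L\<rceil>..\<lceil>L\<rceil>}"
    by (auto simp: abs_le_iff) linarith+
qed simp

text \<open>For positive \<open>p\<close> the sum is \<open>(p - m) + m = p\<close>, for negative
  \<open>p\<close> it is \<open>- p + m = m - p\<close>. Both signs give the same product, to which
  the divisibility for \<open>P x * (P x - M)\<close> applies.\<close>

lemma abc_triple_of_int:
  fixes p :: int and m :: nat
  assumes "\<bar>p\<bar> > int m"
  obtains u :: nat where "u > 0" "\<bar>p\<bar> \<le> int (u + m)" "int (u * (u + m)) = p * (p - int m)"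
proof (cases "p > 0")
  case True
  then show ?thesis
    using assms by (intro that[of "nat (p - int m)"]) auto
next
  case False
  then show ?thesis
    using assms by (intro that[of "nat (- p)"]) (auto simp: algebra_simps)
qed

section \<open>Finiteness of powerful values and of the solutions\<close>

theorem finite_powerful_values:
  fixes f :: "int poly"
  assumes ABC_Conjecture "separable_int_poly f" "degree f > 2"
  shows "finite {x::int. \<forall>p::nat. prime p \<longrightarrow> int p dvd poly f x \<longrightarrow> int p ^ 2 dvd poly f x}"
    (is "finite ?S")
proof -
  obtain P H M K N where PH: "degree P > 0" "H \<noteq> 0" "degree f + degree H = degree P + 1" "M > 0" "K > 0"
    and dvd: "\<And>x. poly P x * (poly P x - int M) dvd int K * (poly f x * poly H x) ^ N"
    using exists_integral_belyi_poly[OF assms(2)] by metis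
  define D where "D = real (degree P)"
  \<comment> \<open>Chosen so that \<open>(D - 1 / 2) * (1 + \<epsilon>)\<close> stays below
    \<open>D - 1 / 4\<close>.\<close>
  define \<epsilon> where "\<epsilon> = 1 / (4 * D)"
  have D: "D > 0" using PH by (simp add: D_def)
  then have "\<epsilon> > 0" by (simp add: \<epsilon>_def)
  with assms(1) obtain C where C: "C > 0"
    "\<And>u m :: nat. u > 0 \<Longrightarrow> m > 0 \<Longrightarrow> real (u + m) \<le> real m * C * real (abc_N u m (u + m)) powr (1 + \<epsilon>)"
    by (rule ABC_without_coprimality) blast
  obtain X where X: "\<And>x. \<bar>real_of_int x\<bar> \<ge> X \<Longrightarrow> \<bar>real_of_int (poly P x)\<bar> \<ge> \<bar>real_of_int x\<bar> ^ degree P / 2"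
    by (rule poly_abs_lower_bound[OF PH(1)]) blast
  obtain Bf where Bf: "Bf > 0" "\<And>x. \<bar>x\<bar> \<ge> 1 \<Longrightarrow> \<bar>real_of_int (poly f x)\<bar> \<le> Bf * \<bar>real_of_int x\<bar> ^ degree f"
    by (rule poly_abs_upper_bound[of f]) blast
  obtain BH where BH: "BH > 0" "\<And>x. \<bar>x\<bar> \<ge> 1 \<Longrightarrow> \<bar>real_of_int (poly H x)\<bar> \<le> BH * \<bar>real_of_int x\<bar> ^ degree H"
    by (rule poly_abs_upper_bound[of H]) blast
  define W where "W = sqrt Bf * (BH * real (K * M))"
  define A where "A = 2 * (real M * C * W powr (1 + \<epsilon>))"
  have W: "W > 0" using Bf BH PH by (simp add: W_def)
  have A: "A > 0" using W C PH by (simp add: A_def)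
  \<comment> \<open>Beyond \<open>X\<close> the lower bound for \<open>P x\<close> holds,
    \<open>2 * M\<close> makes \<open>\<bar>P x\<bar>\<close> exceed \<open>M\<close>, 1 makes
    powers of \<open>t\<close> monotone in the exponent, and \<open>A ^ 4\<close> contradicts the
    final estimate.\<close>
  define L where "L = Max {X, 2 * real M, 1, A ^ 4}"
  have "?S \<subseteq> {x. poly (f * H) x = 0} \<union> {x. \<bar>real_of_int x\<bar> \<le> L}"
  proof (rule subsetI, rule ccontr)
    fix x assume "x \<in> ?S" and "x \<notin> {x. poly (f * H) x = 0} \<union> {x. \<bar>real_of_int x\<bar> \<le> L}"
    then have powerful: "\<And>p::nat. prime p \<Longrightarrow> int p dvd poly f x \<Longrightarrow> int p ^ 2 dvd poly f x"
      and nz: "poly f x \<noteq> 0" "poly H x \<noteq> 0" and "\<bar>real_of_int x\<bar> > L"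
      by auto
    define t where "t = \<bar>real_of_int x\<bar>"
    have t: "t > X" "t > 2 * real M" "t > 1" "t > A ^ 4"
      using \<open>\<bar>real_of_int x\<bar> > L\<close> by (simp_all add: L_def t_def)
    then have x1: "\<bar>x\<bar> \<ge> 1" by (simp add: t_def)
    define F where "F = nat \<bar>poly f x\<bar>"
    define h where "h = nat \<bar>poly H x\<bar>"
    have pos: "F > 0" "h > 0" using nz by (simp_all add: F_def h_def)
    have Pt: "t ^ degree P / 2 \<le> \<bar>real_of_int (poly P x)\<bar>"
      using X[of x] t by (simp add: t_def)
    have "t \<le> t ^ degree P"
      using t PH power_increasing[of 1 "degree P" t] by simp
    with Pt t have "real M < \<bar>real_of_int (poly P x)\<bar>" by linarith
    then have "int M < \<bar>poly P x\<bar>" by linarith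
    then obtain u where u: "u > 0" "\<bar>poly P x\<bar> \<le> int (u + M)"
      "int (u * (u + M)) = poly P x * (poly P x - int M)"
      by (rule abc_triple_of_int)
    \<comment> \<open>A prime dividing a power divides its base, so the exponent \<open>N\<close>
      disappears; \<open>K\<close> and \<open>M\<close> enter only as constants.\<close>
    have "p dvd F * (h * (K * M))" if p: "prime p" and "p dvd u * M * (u + M)" for p
    proof -
      from that consider "p dvd M" | "p dvd u * (u + M)"
        by (auto simp: prime_dvd_mult_iff)
      then show ?thesis
      proof cases
        case 2
        then have "int p dvd int K * (poly f x * poly H x) ^ N"
          using dvd[of x] u(3) by (metis dvd_trans of_nat_dvd_iff)
        then have "int p dvd int K * (poly f x * poly H x)"
          using p prime_dvd_power[of "int p" "poly f x * poly H x" N]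
          by (auto simp: prime_dvd_mult_iff[of "int p" "int K"])
        then have "p dvd nat \<bar>int K * (poly f x * poly H x)\<bar>"
          by (simp add: dvd_nat_abs_iff)
        also have "\<dots> = K * (F * h)"
          by (simp add: abs_mult nat_mult_distrib F_def h_def)
        finally have "p dvd (K * (F * h)) * M" by (rule dvd_mult2)
        then show ?thesis by (simp add: mult_ac)
      qed auto
    qed
    then have "abc_N u M (u + M) \<le> \<Prod>(prime_factors F) * (h * (K * M))"
      unfolding abc_N_def using pos PH by (intro prod_prime_factors_le_mult) auto
    then have "real (abc_N u M (u + M)) \<le> real (\<Prod>(prime_factors F)) * (real h * real (K * M))"
      by (simp only: of_nat_mult [symmetric] of_nat_le_iff)
    also have "\<dots> \<le> sqrt (Bf * t ^ degree f) * (BH * t ^ degree H * real (K * M))"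
    proof (intro mult_mono)
      have "p ^ 2 dvd F" if "prime p" "p dvd F" for p
        using powerful[of p] that by (simp add: F_def dvd_nat_abs_iff)
      then have "\<Prod>(prime_factors F) ^ 2 \<le> F"
        using pos by (intro dvd_imp_le prod_prime_factors_square_dvd)
      then have "(real (\<Prod>(prime_factors F))) ^ 2 \<le> real F"
        by (simp only: of_nat_power [symmetric] of_nat_le_iff)
      also have "\<dots> \<le> Bf * t ^ degree f"
        using Bf(2)[OF x1] by (simp add: F_def t_def)
      finally show "real (\<Prod>(prime_factors F)) \<le> sqrt (Bf * t ^ degree f)"
        by (rule real_le_rsqrt)
      show "real h \<le> BH * t ^ degree H"
        using BH(2)[OF x1] by (simp add: h_def t_def)
    qed (use Bf BH t in auto)
    also have "\<dots> = W * (sqrt (t ^ degree f) * t ^ degree H)"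
      by (simp add: W_def real_sqrt_mult)
    also have "sqrt (t ^ degree f) = t powr (real (degree f) / 2)"
      using t by (simp add: powr_half_sqrt [symmetric] powr_powr flip: powr_realpow)
    also have "t ^ degree H = t powr real (degree H)"
      using t by (simp add: powr_realpow)
    \<comment> \<open>By the degree relation the exponent is \<open>D + 1 - degree f / 2\<close>,
      which is at most \<open>D - 1 / 2\<close> exactly because
      \<open>degree f \<ge> 3\<close>.\<close>
    also have "t powr (real (degree f) / 2) * t powr real (degree H) \<le> t powr (D - 1 / 2)"
    proof -
      have "real (degree f) + real (degree H) = D + 1"
        using PH(3) unfolding D_def by linarith
      moreover have "real (degree f) \<ge> 3" using assms(3) by simp
      ultimately show ?thesis
        unfolding powr_add [symmetric] using t by (intro powr_mono) auto
    qed
    finally have rad: "real (abc_N u M (u + M)) \<le> W * t powr (D - 1 / 2)"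
      using W by (simp add: mult_left_mono)
    have "t powr D / 2 \<le> real (u + M)"
      using Pt u(2) t by (simp add: D_def powr_realpow)
    also have "\<dots> \<le> real M * C * real (abc_N u M (u + M)) powr (1 + \<epsilon>)"
      using u PH by (intro C(2))
    also have "\<dots> \<le> real M * C * (W * t powr (D - 1 / 2)) powr (1 + \<epsilon>)"
      using rad C(1) \<open>\<epsilon> > 0\<close> by (intro mult_left_mono powr_mono2) auto
    also have "\<dots> = A / 2 * t powr ((D - 1 / 2) * (1 + \<epsilon>))"
      using W by (simp add: A_def powr_mult powr_powr)
    also have "\<dots> \<le> A / 2 * t powr (D - 1 / 4)"
    proof (intro mult_left_mono powr_mono)
      have "(D - 1 / 2) * (1 + \<epsilon>) = D - 1 / 4 - \<epsilon> / 2"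
        using D by (simp add: \<epsilon>_def field_simps)
      then show "(D - 1 / 2) * (1 + \<epsilon>) \<le> D - 1 / 4" using \<open>\<epsilon> > 0\<close> by simp
    qed (use A t in auto)
    finally have "t powr D \<le> A * t powr (D - 1 / 4)" by simp
    also have "t powr D = t powr (1 / 4) * t powr (D - 1 / 4)"
      by (simp flip: powr_add)
    finally have "t powr (1 / 4) \<le> A" using t by simp
    then have "(t powr (1 / 4)) ^ 4 \<le> A ^ 4" by (intro power_mono) auto
    also have "(t powr (1 / 4)) ^ 4 = t"
      using t by (simp add: powr_power)
    finally show False using t by simp
  qed
  moreover have "f * H \<noteq> 0" using assms(3) PH(2) by auto
  ultimately show ?thesis
    using finite_subset[of ?S] poly_roots_finite[of "f * H"] finite_bounded_ints by blast
qed

lemma powerful_prod_power: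
  fixes a :: "'b \<Rightarrow> int" and \<gamma> :: "'b \<Rightarrow> nat"
  assumes "finite I" "\<And>i. i \<in> I \<Longrightarrow> \<gamma> i \<ge> 2" "prime p" "p dvd (\<Prod>i\<in>I. a i ^ \<gamma> i)"
  shows "p ^ 2 dvd (\<Prod>i\<in>I. a i ^ \<gamma> i)"
proof -
  obtain i where i: "i \<in> I" "p dvd a i ^ \<gamma> i"
    using assms by (auto simp: prime_dvd_prod_iff)
  then have "p dvd a i" using assms(3) prime_dvd_power by blast
  then have "p ^ 2 dvd a i ^ \<gamma> i"
    using assms(2)[OF i(1)] by (meson dvd_power_same dvd_trans le_imp_power_dvd)
  also have "\<dots> dvd (\<Prod>i\<in>I. a i ^ \<gamma> i)"
    using i assms(1) by (intro dvd_prodI) auto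
  finally show ?thesis .
qed

theorem theorem1p6:
  fixes f g :: "int poly" and gs :: "nat \<Rightarrow> int poly" and \<gamma> :: "nat \<Rightarrow> nat" and n :: nat
  assumes "separable_int_poly f"
    and "degree f > 2"
    and "n \<ge> 1"
    and "\<And>i. i \<in> {1..n} \<Longrightarrow> \<gamma> i \<ge> 2"
    and "g = (\<Prod>i=1..n. gs i ^ \<gamma> i)"
    and "degree g > 0"
    and ABC_Conjecture
  shows "finite {(x::int, y::int). poly f x = poly g y}"
proof -
  let ?S = "{x::int. \<forall>p::nat. prime p \<longrightarrow> int p dvd poly f x \<longrightarrow> int p ^ 2 dvd poly f x}"
  have g: "poly g y = (\<Prod>i=1..n. poly (gs i) y ^ \<gamma> i)" for y
    by (simp add: assms(5) poly_prod)
  have "int p ^ 2 dvd poly g y" if "prime p" "int p dvd poly g y" for p y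
    using that assms(4) unfolding g by (intro powerful_prod_power) auto
  then have "{(x::int, y::int). poly f x = poly g y} \<subseteq> (SIGMA x:?S. {y. poly (g - [:poly f x:]) y = 0})"
    by auto
  \<comment> \<open>For fixed \<open>x\<close>, the nonconstant polynomial
    \<open>g - [:poly f x:]\<close> has finitely many roots; with constant \<open>g\<close>, one
    solution \<open>x\<close> would admit every \<open>y\<close>.\<close>
  moreover have "finite {y. poly (g - [:c:]) y = 0}" for c
  proof (rule poly_roots_finite)
    show "g - [:c:] \<noteq> 0" using assms(6) by auto
  qed
  then have "finite (SIGMA x:?S. {y. poly (g - [:poly f x:]) y = 0})"
    using finite_powerful_values[OF assms(7,1,2)] by (intro finite_SigmaI) auto
  ultimately show ?thesis by (rule finite_subset)
qed

end
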